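(* Let $X$ be a continuous random variable with continuously differentiable density $f$, and suppose there is $M>0$ such that $f(x)=0$ for all $x<0$ and all $x>M$. Suppose there is a constant $C>0$ such that $$\max(|f(x)|,|f'(x)|)\le C\quad\text{for all }0\le x\le M.$$ For $m\ge 1$ let $Y_m$ be a discrete random variable with distribution $$\mathbb{P}_m\left(Y_m=\frac{l}{m}\right)=\frac{f\left(\frac{l}{m}\right)}{\sum_{0\le l'\le Mm}f\left(\frac{l'}{m}\right)},\qquad l=0,1,2,\ldots,\ l\le Mm,$$ and let $X_{m,1},X_{m,2},\ldots$ be i.i.d. with the same distribution as $Y_m$, defined on a probability space $(\Omega_m,\mathcal{F}_m,\mathbb{P}_m)$. Let $\{n_t\}_{t\ge 1}$ be a strictly increasing sequence of positive integers with comparison sets $\mathcal{C}(n_t)\subseteq\{1,2,\ldots,n_t-1\}$ such that (i) $\mathcal{C}(n_1)\subsetneq \mathcal{C}(n_2)\subsetneq\cdots$ and (ii) $n_{t-1}\in\mathcal{C}(n_t)$ for all $t\ge 2$. For $n\in\{n_t\}$ let $A_n=\{X_{m,n}>\max_{j\in\mathcal{C}(n)}X_{m,j}\}$ and $c(n)=\#\mathcal{C}(n)+1$. Then for any fixed finite set of (distinct) indices $\{i_1,\ldots,i_k\}\subset\{n_t\}$ there is a constant $D=D(i_1,\ldots,i_k)>0$ (independent of $m$) such that $$\left|\mathbb{P}_m\left(A_{i_1}\cap A_{i_2}\cap\cdots\cap A_{i_k}\right)-\frac{1}{c(i_1)\,c(i_2)\cdots c(i_k)}\right|\le\frac{D}{m}$$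 for all $m$ large.
   Context: $\#S$ denotes the cardinality of a finite set $S$. If a comparison set is empty, the corresponding maximum is taken to be $-\infty$, so that the record event always occurs. The index $l'$ in the normalizing sum runs over integers; the distribution of $Y_m$ is considered for those $m$ for which the normalizing sum is positive, which holds for all $m$ large. *)

theory Defs
  imports "HOL-Probability.Probability"
begin

definition grid :: "real \<Rightarrow> nat \<Rightarrow> nat set" where
  "grid M m = {l. real l \<le> M * real m}"

definition normalizer :: "(real \<Rightarrow> real) \<Rightarrow> real \<Rightarrow> nat \<Rightarrow> real" where
  "normalizer f M m = (\<Sum>l\<in>grid M m. f (real l / real m))"

text \<open>The prescribed point masses sum to one whenever the normalizer is nonzero, so on a
  probability space they determine the distribution of \<open>Y\<close>; no separate clause for values
  off the lattice is needed.\<close>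

definition has_lattice_distribution ::
    "'w measure \<Rightarrow> ('w \<Rightarrow> real) \<Rightarrow> (real \<Rightarrow> real) \<Rightarrow> real \<Rightarrow> nat \<Rightarrow> bool" where
  "has_lattice_distribution P Y f M m \<longleftrightarrow>
     Y \<in> borel_measurable P \<and>
     (\<forall>l\<in>grid M m.
        measure P {\<omega> \<in> space P. Y \<omega> = real l / real m}
          = f (real l / real m) / normalizer f M m)"

definition iid_copies :: "'w measure \<Rightarrow> (nat \<Rightarrow> 'w \<Rightarrow> real) \<Rightarrow> ('w \<Rightarrow> real) \<Rightarrow> bool" where
  "iid_copies P X Y \<longleftrightarrow>
     prob_space.indep_vars P (\<lambda>_. borel) X {1..} \<and>
     (\<forall>j\<ge>1. distr P borel (X j) = distr P borel Y)"

text \<open>\<open>Max\<close> is unspecified on the empty set; the guard implements the convention that an empty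
  maximum is minus infinity.\<close>

definition record_event ::
    "'w measure \<Rightarrow> (nat \<Rightarrow> 'w \<Rightarrow> real) \<Rightarrow> (nat \<Rightarrow> nat set) \<Rightarrow> nat \<Rightarrow> 'w set" where
  "record_event P X Cmp n =
     {\<omega> \<in> space P. Cmp n \<noteq> {} \<longrightarrow> Max ((\<lambda>j. X j \<omega>) ` Cmp n) < X n \<omega>}"

definition rank_count :: "(nat \<Rightarrow> nat set) \<Rightarrow> nat \<Rightarrow> nat" where
  "rank_count Cmp n = card (Cmp n) + 1"

end

theory Submission
  imports Defs
begin

text \<open>
  If the common law of the \<open>X\<^sub>j\<close> had no atoms, with distribution function \<open>F\<close>, then the events
  \<open>A\<^sub>i\<close> would be independent with probabilities \<open>1 / c(i)\<close>; this comes from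
  \<open>\<integral> F\<^sup>k dF = F\<^sup>k\<^sup>+\<^sup>1 / (k+1)\<close> over a half-line. For a law with atoms of mass at most \<open>q\<close>
  the same identity holds up to an error \<open>k q\<close> (\<open>partial_sum_power_error\<close>), and every
  other step of the computation is exact.

  The computation is an induction on the set of record indices. It needs more than the bare
  probability of the records, namely the probability \<open>R(I, J, x)\<close> that the records at \<open>I\<close> occur
  and that all \<open>X\<^sub>j\<close>, \<open>j \<in> J\<close>, are below \<open>x\<close>, where \<open>J\<close> contains all indices involved. Let \<open>b\<close> be
  the largest record index. Since the comparison sets are nested and each contains the preceding
  record indices, the earlier records depend only on the \<open>X\<^sub>j\<close> with \<open>j\<close> in the comparison set of
  \<open>b\<close>. Conditioning on the value \<open>v\<close> of \<open>X\<^sub>b\<close> therefore gives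
  \<open>R(I \<union> {b}, Cmp b \<union> {b}, x) = (\<Sum>v<x. P(X\<^sub>b = v) R(I, Cmp b, v))\<close>, and the induction hypothesis
  turns the right-hand side into the sum just mentioned. Indices of \<open>J\<close> outside
  \<open>Cmp b \<union> {b}\<close> only contribute a factor \<open>F(x)\<close> each. The errors add up to at most
  \<open>q\<close> times the sum of the sizes of the comparison sets (\<open>records_below_error\<close>, \<open>records_error\<close>).

  It remains to see that \<open>q\<close> is of order \<open>1/m\<close> for the lattice law. As \<open>f \<le> C\<close>, it suffices that the
  normalizer is at least \<open>m / 2\<close> for large \<open>m\<close>. The normalizer divided by \<open>m\<close> is a Riemann sum of a
  Lipschitz density of total mass one, so it is at least \<open>1 - O(1/m)\<close> (\<open>normalizer_lower_bound\<close>).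
\<close>

section \<open>A discrete form of the integral of a power\<close>

lemma power_increment_le:
  fixes a p :: real
  assumes "0 \<le> a" "0 \<le> p" "a + p \<le> 1"
  shows "(a + p) ^ k - a ^ k \<le> real k * p"
proof (induction k)
  case 0
  then show ?case by simp
next
  case (Suc k)
  have "(a + p) ^ Suc k - a ^ Suc k = (a + p) * ((a + p) ^ k - a ^ k) + p * a ^ k"
    by (simp add: algebra_simps)
  also have "(a + p) * ((a + p) ^ k - a ^ k) \<le> 1 * (real k * p)"
    using assms Suc by (intro mult_mono) (auto intro: power_mono)
  also have "p * a ^ k \<le> p * 1"
    using assms by (intro mult_left_mono power_le_one) auto
  finally show ?case by (simp add: algebra_simps)
qed

text \<open>The next bound is quadratic in \<open>p\<close>, so that summed over the atoms of a probability
  distribution it contributes no more than the largest atom, up to a factor depending on \<open>k\<close>.\<close>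

lemma power_linearization:
  fixes a p :: real
  assumes "0 \<le> a" "0 \<le> p" "a + p \<le> 1"
  shows "\<bar>(a + p) ^ Suc k - a ^ Suc k - real (Suc k) * (p * a ^ k)\<bar> \<le> real (Suc k) * (real k * p\<^sup>2)"
proof (induction k)
  case 0
  then show ?case by simp
next
  case (Suc k)
  define d where "d = (a + p) ^ Suc k - a ^ Suc k - real (Suc k) * (p * a ^ k)"
  have "(a + p) ^ Suc (Suc k) - a ^ Suc (Suc k) - real (Suc (Suc k)) * (p * a ^ Suc k)
      = a * d + p * ((a + p) ^ Suc k - a ^ Suc k)"
    by (simp add: algebra_simps d_def)
  also have "\<bar>\<dots>\<bar> \<le> \<bar>a * d\<bar> + \<bar>p * ((a + p) ^ Suc k - a ^ Suc k)\<bar>"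
    by (rule abs_triangle_ineq)
  also have "\<bar>a * d\<bar> \<le> 1 * (real (Suc k) * (real k * p\<^sup>2))"
    unfolding abs_mult using assms Suc unfolding d_def by (intro mult_mono) auto
  also have "\<bar>p * ((a + p) ^ Suc k - a ^ Suc k)\<bar> = p * ((a + p) ^ Suc k - a ^ Suc k)"
    using assms by (intro abs_of_nonneg mult_nonneg_nonneg) (auto intro!: power_mono simp del: power_Suc)
  also have "\<dots> \<le> p * (real (Suc k) * p)"
    using assms by (intro mult_left_mono power_increment_le) auto
  finally have "\<bar>(a + p) ^ Suc (Suc k) - a ^ Suc (Suc k) - real (Suc (Suc k)) * (p * a ^ Suc k)\<bar>
     \<le> real (Suc k) * real (Suc k) * p\<^sup>2"
    by (simp add: algebra_simps power2_eq_square)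
  also have "\<dots> \<le> real (Suc (Suc k)) * real (Suc k) * p\<^sup>2"
    by (intro mult_right_mono) auto
  finally show ?case by (simp only: mult.assoc)
qed

text \<open>With \<open>F\<close> the partial sums of \<open>p\<close>, this is \<open>\<integral> F\<^sup>k dF = F\<^sup>k\<^sup>+\<^sup>1 / (k+1)\<close> up to the effect of the
  jumps: the increments of \<open>F\<^sup>k\<^sup>+\<^sup>1 / (k+1)\<close> telescope, and each differs from \<open>p l * F\<^sup>k\<close> by at most
  \<open>k * (p l)\<^sup>2 \<le> p l * (k * q)\<close>.\<close>

lemma partial_sum_power_error:
  fixes p :: "nat \<Rightarrow> real"
  assumes nonneg: "\<And>l. l < N \<Longrightarrow> 0 \<le> p l" and le_q: "\<And>l. l < N \<Longrightarrow> p l \<le> q"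
    and total: "sum p {..<N} = 1" and "L \<le> N"
  shows "\<bar>(\<Sum>l<L. p l * sum p {..<l} ^ k) - sum p {..<L} ^ Suc k / real (Suc k)\<bar> \<le> real k * q"
proof -
  define F where "F l = sum p {..<l}" for l
  have mono: "F l \<le> 1" if "l \<le> N" for l
    using total sum_mono2[of "{..<N}" "{..<l}" p] that nonneg unfolding F_def by fastforce
  have step: "\<bar>p l * F l ^ k - (F (Suc l) ^ Suc k - F l ^ Suc k) / real (Suc k)\<bar> \<le> p l * (real k * q)"
    if "l < N" for l
  proof -
    have F: "F (Suc l) = F l + p l" "0 \<le> F l" "0 \<le> p l" "p l \<le> q" "F l + p l \<le> 1"
      using that mono[of "Suc l"] nonneg le_q by (auto simp: F_def intro!: sum_nonneg)
    let ?r = "(F l + p l) ^ Suc k - F l ^ Suc k - real (Suc k) * (p l * F l ^ k)"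
    have "p l * F l ^ k - (F (Suc l) ^ Suc k - F l ^ Suc k) / real (Suc k) = - ?r / real (Suc k)"
      unfolding F(1) by (simp add: field_simps del: power_Suc of_nat_Suc)
    also have "\<bar>\<dots>\<bar> = \<bar>?r\<bar> / real (Suc k)"
      by (simp only: abs_divide abs_minus_cancel abs_of_nat)
    also have "\<dots> \<le> real (Suc k) * (real k * (p l)\<^sup>2) / real (Suc k)"
      using F by (intro divide_right_mono power_linearization) auto
    also have "\<dots> = p l * (real k * p l)"
      by (simp add: power2_eq_square del: of_nat_Suc)
    also have "\<dots> \<le> p l * (real k * q)"
      using F by (intro mult_left_mono) auto
    finally show ?thesis .
  qed
  have telescope: "(\<Sum>l<L. (F (Suc l) ^ Suc k - F l ^ Suc k) / real (Suc k)) = F L ^ Suc k / real (Suc k)"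
    unfolding sum_divide_distrib[symmetric] sum_lessThan_telescope[of "\<lambda>l. F l ^ Suc k"]
    by (simp add: F_def)
  have "0 < N" using total by (cases N) auto
  then have q: "0 \<le> q"
    using nonneg[of 0] le_q[of 0] by linarith
  have "\<bar>(\<Sum>l<L. p l * F l ^ k) - F L ^ Suc k / real (Suc k)\<bar>
      = \<bar>\<Sum>l<L. p l * F l ^ k - (F (Suc l) ^ Suc k - F l ^ Suc k) / real (Suc k)\<bar>"
    unfolding telescope[symmetric] sum_subtractf ..
  also have "\<dots> \<le> (\<Sum>l<L. p l * (real k * q))"
    using \<open>L \<le> N\<close> by (intro order_trans[OF sum_abs] sum_mono step) auto
  also have "\<dots> = F L * (real k * q)"
    by (simp add: F_def sum_distrib_right)
  also have "\<dots> \<le> real k * q"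
    using mult_right_mono[OF mono[OF \<open>L \<le> N\<close>], of "real k * q"] q by simp
  finally show ?thesis unfolding F_def .
qed

section \<open>Records of independent variables with small atoms\<close>

text \<open>The values are listed in increasing order as \<open>v 0, v 1, \<dots>\<close>, so that order relations between
  the variables can be read off their indices; only the first \<open>N\<close> values carry mass, and \<open>v N\<close>
  serves as a threshold above all of them.\<close>

locale iid_atomic = prob_space +
  fixes X :: "nat \<Rightarrow> 'a \<Rightarrow> real" and T :: "nat set"
    and v p :: "nat \<Rightarrow> real" and N :: nat and q :: real
  assumes indep: "indep_vars (\<lambda>_. borel) X T"
    and atom: "\<And>j l. j \<in> T \<Longrightarrow> l < N \<Longrightarrow> prob {\<omega> \<in> space M. X j \<omega> = v l} = p l"
    and total: "sum p {..<N} = 1"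
    and strict_mono_v: "strict_mono v"
    and p_nonneg: "\<And>l. l < N \<Longrightarrow> 0 \<le> p l"
    and p_le: "\<And>l. l < N \<Longrightarrow> p l \<le> q"
begin

abbreviation F :: "nat \<Rightarrow> real" where "F L \<equiv> sum p {..<L}"

text \<open>The threshold on the variables indexed by \<open>J\<close> is what makes an induction on \<open>I\<close> possible: the
  value of the last record becomes the threshold for the earlier ones.\<close>

definition records_below :: "(nat \<Rightarrow> nat set) \<Rightarrow> nat set \<Rightarrow> nat set \<Rightarrow> nat \<Rightarrow> 'a set" where
  "records_below Cmp I J L =
     {\<omega> \<in> space M. (\<forall>i\<in>I. \<forall>j\<in>Cmp i. X j \<omega> < X i \<omega>) \<and> (\<forall>j\<in>J. X j \<omega> < v L)}"

lemma measurable_X [measurable]: "j \<in> T \<Longrightarrow> X j \<in> borel_measurable M"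
  using indep by (auto simp: indep_vars_def)

lemma v_eq_iff [simp]: "v l = v l' \<longleftrightarrow> l = l'"
  using strict_mono_v by (rule strict_mono_eq)

lemma v_less_iff [simp]: "v l < v l' \<longleftrightarrow> l < l'"
  using strict_mono_v by (rule strict_mono_less)

lemma q_nonneg: "0 \<le> q"
proof -
  have "0 < N" using total by (cases N) auto
  then show ?thesis using p_nonneg[of 0] p_le[of 0] by linarith
qed

lemma F_le_1: "L \<le> N \<Longrightarrow> F L \<le> 1"
  using total sum_mono2[of "{..<N}" "{..<L}" p] p_nonneg by fastforce

lemma F_nonneg: "L \<le> N \<Longrightarrow> 0 \<le> F L"
  using p_nonneg by (intro sum_nonneg) auto

lemma AE_atom:
  assumes "j \<in> T"
  shows "AE \<omega> in M. \<exists>l<N. X j \<omega> = v l"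
proof -
  have [measurable]: "X j \<in> borel_measurable M" using assms by simp
  have "prob (\<Union>l<N. {\<omega> \<in> space M. X j \<omega> = v l}) = (\<Sum>l<N. prob {\<omega> \<in> space M. X j \<omega> = v l})"
    by (rule finite_measure_finite_Union) (auto simp: disjoint_family_on_def)
  also have "\<dots> = 1"
    using atom[OF assms] total by simp
  finally show ?thesis
    by (auto dest!: AE_prob_1)
qed

lemma prob_slice:
  assumes "j \<in> T" "L \<le> N" and E: "E \<in> events"
  shows "prob (E \<inter> {\<omega> \<in> space M. X j \<omega> < v L}) = (\<Sum>l<L. prob (E \<inter> {\<omega> \<in> space M. X j \<omega> = v l}))"
proof -
  have [measurable]: "X j \<in> borel_measurable M" "E \<in> events" using assms by auto
  have "prob (E \<inter> {\<omega> \<in> space M. X j \<omega> < v L}) = prob (\<Union>l<L. E \<inter> {\<omega> \<in> space M. X j \<omega> = v l})"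
  proof (rule finite_measure_eq_AE)
    show "AE \<omega> in M. \<omega> \<in> E \<inter> {\<omega> \<in> space M. X j \<omega> < v L} \<longleftrightarrow>
        \<omega> \<in> (\<Union>l<L. E \<inter> {\<omega> \<in> space M. X j \<omega> = v l})"
      using AE_atom[OF \<open>j \<in> T\<close>]
      by eventually_elim auto
  qed auto
  also have "\<dots> = (\<Sum>l<L. prob (E \<inter> {\<omega> \<in> space M. X j \<omega> = v l}))"
    by (rule finite_measure_finite_Union) (auto simp: disjoint_family_on_def)
  finally show ?thesis .
qed

lemma prob_less:
  assumes "j \<in> T" "L \<le> N"
  shows "prob {\<omega> \<in> space M. X j \<omega> < v L} = F L"
proof -
  have "space M \<inter> {\<omega> \<in> space M. Q \<omega>} = {\<omega> \<in> space M. Q \<omega>}" for Q by auto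
  then show ?thesis
    using prob_slice[OF assms, of "space M"] assms by (simp add: atom)
qed

lemma records_below_event:
  assumes "finite I" "finite J" "J \<subseteq> T" "\<And>i. i \<in> I \<Longrightarrow> finite (Cmp i) \<and> insert i (Cmp i) \<subseteq> T"
  shows "records_below Cmp I J L \<in> events"
proof -
  have [measurable]: "Measurable.pred M (\<lambda>\<omega>. X j \<omega> < X i \<omega>)" if "i \<in> I" "j \<in> Cmp i" for i j
  proof -
    have [measurable]: "X i \<in> borel_measurable M" "X j \<in> borel_measurable M"
      using assms(4)[OF that(1)] that by auto
    show ?thesis by measurable
  qed
  have [measurable]: "Measurable.pred M (\<lambda>\<omega>. X j \<omega> < v L)" if "j \<in> J" for j
  proof -
    have [measurable]: "X j \<in> borel_measurable M" using assms that by auto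
    show ?thesis by measurable
  qed
  have "Measurable.pred M (\<lambda>\<omega>. (\<forall>i\<in>I. \<forall>j\<in>Cmp i. X j \<omega> < X i \<omega>) \<and> (\<forall>j\<in>J. X j \<omega> < v L))"
    using assms by (intro pred_intros_logic pred_intros_finite) auto
  then show ?thesis
    by (simp add: records_below_def pred_def)
qed

text \<open>The event only involves variables indexed by \<open>J\<close>, which contains the record indices and
  their comparison sets, so it is the preimage of a measurable set of the product space over
  \<open>J\<close>.\<close>

lemma records_below_indep:
  assumes fin: "finite I" "finite J" and J: "J \<subseteq> T" "\<And>i. i \<in> I \<Longrightarrow> insert i (Cmp i) \<subseteq> J"
    and b: "b \<in> T" "b \<notin> J" and B: "B \<in> sets borel"
  shows "prob (records_below Cmp I J L \<inter> {\<omega> \<in> space M. X b \<omega> \<in> B}) =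
         prob (records_below Cmp I J L) * prob {\<omega> \<in> space M. X b \<omega> \<in> B}"
proof -
  let ?R = "\<lambda>K \<omega>. restrict (\<lambda>i. X i \<omega>) K"
  let ?PJ = "PiM J (\<lambda>_. borel :: real measure)" and ?Pb = "PiM {b} (\<lambda>_. borel :: real measure)"
  define EJ where "EJ = {g \<in> space ?PJ. (\<forall>i\<in>I. \<forall>j\<in>Cmp i. g j < g i) \<and> (\<forall>j\<in>J. g j < v L)}"
  define Eb where "Eb = {g \<in> space ?Pb. g b \<in> B}"
  have finC: "finite (Cmp i)" if "i \<in> I" for i
    using J(2)[OF that] \<open>finite J\<close> by (auto intro: finite_subset)
  have [measurable]: "Measurable.pred ?PJ (\<lambda>g. g j < g i)" if "i \<in> I" "j \<in> Cmp i" for i j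
  proof -
    have "i \<in> J" "j \<in> J" using J(2)[OF that(1)] that by auto
    then have [measurable]: "(\<lambda>g. g i) \<in> borel_measurable ?PJ" "(\<lambda>g. g j) \<in> borel_measurable ?PJ"
      by auto
    show ?thesis by measurable
  qed
  have [measurable]: "Measurable.pred ?PJ (\<lambda>g. g j < v L)" if "j \<in> J" for j
  proof -
    have [measurable]: "(\<lambda>g. g j) \<in> borel_measurable ?PJ" using that by auto
    show ?thesis by measurable
  qed
  have "Measurable.pred ?PJ (\<lambda>g. (\<forall>i\<in>I. \<forall>j\<in>Cmp i. g j < g i) \<and> (\<forall>j\<in>J. g j < v L))"
    using fin finC by (intro pred_intros_logic pred_intros_finite) auto
  then have EJ: "EJ \<in> sets ?PJ"
    by (simp add: EJ_def pred_def)
  have Eb: "Eb \<in> sets ?Pb"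
    unfolding Eb_def using B by measurable
  have "indep_var ?PJ (?R J) ?Pb (?R {b})"
    using J b by (intro indep_var_restrict[OF indep]) auto
  from indep_varD[OF this EJ Eb]
  have "prob ((\<lambda>x. (?R J x, ?R {b} x)) -` (EJ \<times> Eb) \<inter> space M) =
      prob (?R J -` EJ \<inter> space M) * prob (?R {b} -` Eb \<inter> space M)" .
  moreover have "?R J -` EJ \<inter> space M = records_below Cmp I J L"
    using J(2) by (fastforce simp: EJ_def records_below_def space_PiM)
  moreover have "?R {b} -` Eb \<inter> space M = {\<omega> \<in> space M. X b \<omega> \<in> B}"
    by (auto simp: Eb_def space_PiM)
  moreover have "(\<lambda>x. (?R J x, ?R {b} x)) -` (EJ \<times> Eb) \<inter> space M
      = (?R J -` EJ \<inter> space M) \<inter> (?R {b} -` Eb \<inter> space M)"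
    by auto
  ultimately show ?thesis by simp
qed

lemma records_below_extend:
  assumes "finite K" "finite I" "finite J" "J \<union> K \<subseteq> T" "J \<inter> K = {}" "L \<le> N"
    and "\<And>i. i \<in> I \<Longrightarrow> insert i (Cmp i) \<subseteq> J"
  shows "prob (records_below Cmp I (J \<union> K) L) = prob (records_below Cmp I J L) * F L ^ card K"
  using assms
proof (induction K rule: finite_induct)
  case empty
  then show ?case by simp
next
  case (insert b K)
  have "records_below Cmp I (J \<union> insert b K) L
      = records_below Cmp I (J \<union> K) L \<inter> {\<omega> \<in> space M. X b \<omega> \<in> {..<v L}}"
    by (auto simp: records_below_def)
  also have "prob \<dots> = prob (records_below Cmp I (J \<union> K) L) * prob {\<omega> \<in> space M. X b \<omega> \<in> {..<v L}}"
    using insert.prems insert.hyps by (intro records_below_indep) fastforce+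
  also have "prob {\<omega> \<in> space M. X b \<omega> \<in> {..<v L}} = F L"
    using insert.prems by (simp add: prob_less)
  finally show ?case
    using insert by simp
qed

text \<open>The induction removes the largest index \<open>b\<close> from \<open>I\<close>. The hypothesis is applied with
  \<open>J = Cmp b\<close> and every threshold \<open>v l\<close>, the possible values of \<open>X b\<close>; this contributes the error
  of the smaller index set once more, averaged over these values, and the sum of powers adds
  \<open>card (Cmp b) * q\<close>.\<close>

lemma records_below_error:
  assumes "finite I" "finite J" "J \<subseteq> T" "L \<le> N"
    and "\<And>i. i \<in> I \<Longrightarrow> insert i (Cmp i) \<subseteq> J"
    and "\<And>i. i \<in> I \<Longrightarrow> i \<notin> Cmp i"
    and "\<And>i k. i \<in> I \<Longrightarrow> k \<in> I \<Longrightarrow> i < k \<Longrightarrow> insert i (Cmp i) \<subseteq> Cmp k"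
  shows "\<bar>prob (records_below Cmp I J L) - F L ^ card J / (\<Prod>i\<in>I. real (rank_count Cmp i))\<bar>
           \<le> real (\<Sum>i\<in>I. card (Cmp i)) * q"
  using assms
proof (induction I arbitrary: J L rule: finite_linorder_max_induct)
  case empty
  have "records_below Cmp {} {} L = space M" by (simp add: records_below_def)
  then show ?case
    using records_below_extend[of J "{}" "{}" L Cmp] empty by (simp add: prob_space)
next
  case (insert b I)
  define k where "k = card (Cmp b)"
  define c where "c = (\<Prod>i\<in>I. real (rank_count Cmp i))"
  define d where "d = real (\<Sum>i\<in>I. card (Cmp i)) * q"
  define G where "G l = prob (records_below Cmp I (Cmp b) l)" for l
  have c: "1 \<le> c" unfolding c_def by (intro prod_ge_1) (auto simp: rank_count_def)
  have d: "0 \<le> d" using q_nonneg unfolding d_def by (intro mult_nonneg_nonneg of_nat_0_le_iff)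
  have b: "b \<notin> I" "b \<in> T" "b \<in> J" "Cmp b \<subseteq> J" "Cmp b \<subseteq> T" "b \<notin> Cmp b" "finite (Cmp b)"
    using insert.prems insert.hyps by (auto intro: finite_subset)
  have sub: "insert i (Cmp i) \<subseteq> Cmp b" if "i \<in> I" for i
    using insert.prems(6)[of i b] insert.hyps that by auto
  have G: "\<bar>G l - F l ^ k / c\<bar> \<le> d" if "l \<le> N" for l
    unfolding G_def k_def c_def d_def
    using insert.prems b that sub by (intro insert.IH) auto
  (* Every threshold index gives the same event here, as J is empty. *)
  define E where "E = records_below Cmp (insert b I) {} 0"
  have E: "E \<in> events"
    unfolding E_def using insert.prems insert.hyps b
    by (intro records_below_event) (auto intro: finite_subset)
  have slice: "prob (E \<inter> {\<omega> \<in> space M. X b \<omega> = v l}) = p l * G l" if "l < L" for l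
  proof -
    have "E \<inter> {\<omega> \<in> space M. X b \<omega> = v l}
        = records_below Cmp I (Cmp b) l \<inter> {\<omega> \<in> space M. X b \<omega> \<in> {v l}}"
      by (auto simp: records_below_def E_def)
    also have "prob \<dots> = G l * prob {\<omega> \<in> space M. X b \<omega> \<in> {v l}}"
      unfolding G_def using b insert.hyps sub by (intro records_below_indep) auto
    finally show ?thesis
      using that insert.prems b by (simp add: atom)
  qed
  let ?S = "insert b (Cmp b)"
  have "records_below Cmp (insert b I) ?S L = E \<inter> {\<omega> \<in> space M. X b \<omega> < v L}"
    by (auto simp: records_below_def E_def intro: less_trans)
  then have prob_S: "prob (records_below Cmp (insert b I) ?S L) = (\<Sum>l<L. p l * G l)"
    using prob_slice[OF b(2) insert.prems(3) E] slice by simp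
  (* First replace G by its approximation, then the sum of powers by the closed form. *)
  have "\<bar>(\<Sum>l<L. p l * G l) - F L ^ Suc k / (c * real (Suc k))\<bar>
     = \<bar>(\<Sum>l<L. p l * (G l - F l ^ k / c)) + ((\<Sum>l<L. p l * F l ^ k) - F L ^ Suc k / real (Suc k)) / c\<bar>"
    using c by (simp add: algebra_simps sum_subtractf sum_divide_distrib diff_divide_distrib
        del: power_Suc of_nat_Suc)
  also have "\<dots> \<le> \<bar>\<Sum>l<L. p l * (G l - F l ^ k / c)\<bar> + \<bar>((\<Sum>l<L. p l * F l ^ k) - F L ^ Suc k / real (Suc k)) / c\<bar>"
    by (rule abs_triangle_ineq)
  also have "\<bar>\<Sum>l<L. p l * (G l - F l ^ k / c)\<bar> \<le> (\<Sum>l<L. p l * d)"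
    using insert.prems p_nonneg G
    by (intro order_trans[OF sum_abs] sum_mono) (auto simp: abs_mult intro!: mult_left_mono)
  also have "\<dots> = F L * d" by (simp add: sum_distrib_right)
  also have "\<dots> \<le> 1 * d"
    using d F_le_1 insert.prems by (intro mult_right_mono) auto
  also have "\<bar>((\<Sum>l<L. p l * F l ^ k) - F L ^ Suc k / real (Suc k)) / c\<bar> \<le> (real k * q) / 1"
    unfolding abs_divide
    using c insert.prems p_nonneg p_le total q_nonneg
    by (intro frac_le partial_sum_power_error[where N = N]) auto
  finally have S: "\<bar>(\<Sum>l<L. p l * G l) - F L ^ Suc k / (c * real (Suc k))\<bar> \<le> d + real k * q"
    by simp
  (* The indices outside insert b (Cmp b) only enter through the threshold: split them off. *)
  let ?K = "J - ?S"
  have J: "J = ?S \<union> ?K" using b by auto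
  have cardS: "card ?S = Suc k" using b by (simp add: k_def)
  have "finite ?S" using b by simp
  then have cardJ: "card J = Suc k + card ?K"
    using card_Un_disjoint[of ?S ?K] J insert.prems(1) cardS by (metis Diff_disjoint finite_Diff)
  have "prob (records_below Cmp (insert b I) J L)
      = prob (records_below Cmp (insert b I) (?S \<union> ?K) L)"
    using J by simp
  also have "\<dots> = (\<Sum>l<L. p l * G l) * F L ^ card ?K"
    unfolding prob_S[symmetric]
  proof (rule records_below_extend)
    show "insert i (Cmp i) \<subseteq> ?S" if "i \<in> insert b I" for i
      using that sub[of i] by blast
  qed (use insert.prems(1-3) insert.hyps b in auto)
  finally have "\<bar>prob (records_below Cmp (insert b I) J L) - F L ^ card J / (c * real (Suc k))\<bar>
    = \<bar>(\<Sum>l<L. p l * G l) - F L ^ Suc k / (c * real (Suc k))\<bar> * \<bar>F L ^ card ?K\<bar>"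
    unfolding cardJ abs_mult[symmetric] by (simp add: algebra_simps power_add)
  also have "\<dots> \<le> (d + real k * q) * 1"
    using S F_nonneg[of L] F_le_1[of L] insert.prems d q_nonneg
    by (intro mult_mono) (auto intro!: power_le_one)
  finally show ?case
    using b insert.hyps by (simp add: c_def d_def k_def rank_count_def algebra_simps)
qed

text \<open>The threshold \<open>v N\<close> exceeds all variables almost surely, so it can be dropped.\<close>

lemma records_error:
  assumes "finite I" "\<And>i. i \<in> I \<Longrightarrow> finite (Cmp i) \<and> insert i (Cmp i) \<subseteq> T"
    and "\<And>i. i \<in> I \<Longrightarrow> i \<notin> Cmp i"
    and "\<And>i k. i \<in> I \<Longrightarrow> k \<in> I \<Longrightarrow> i < k \<Longrightarrow> insert i (Cmp i) \<subseteq> Cmp k"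
  shows "\<bar>prob {\<omega> \<in> space M. \<forall>i\<in>I. \<forall>j\<in>Cmp i. X j \<omega> < X i \<omega>} - 1 / (\<Prod>i\<in>I. real (rank_count Cmp i))\<bar>
           \<le> real (\<Sum>i\<in>I. card (Cmp i)) * q"
proof -
  define J where "J = (\<Union>i\<in>I. insert i (Cmp i))"
  have J: "finite J" "J \<subseteq> T" using assms by (auto simp: J_def)
  have "AE \<omega> in M. \<forall>j\<in>J. \<exists>l<N. X j \<omega> = v l"
    using J AE_atom by (intro AE_finite_allI) auto
  then have "AE \<omega> in M. \<omega> \<in> records_below Cmp I J N \<longleftrightarrow> \<omega> \<in> records_below Cmp I {} N"
    by eventually_elim (fastforce simp: records_below_def)
  then have "prob (records_below Cmp I J N) = prob (records_below Cmp I {} N)"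
    using assms J by (intro finite_measure_eq_AE records_below_event) auto
  moreover have "records_below Cmp I {} N = {\<omega> \<in> space M. \<forall>i\<in>I. \<forall>j\<in>Cmp i. X j \<omega> < X i \<omega>}"
    by (simp add: records_below_def)
  moreover have "\<bar>prob (records_below Cmp I J N) - F N ^ card J / (\<Prod>i\<in>I. real (rank_count Cmp i))\<bar>
      \<le> real (\<Sum>i\<in>I. card (Cmp i)) * q"
    using assms J by (intro records_below_error) (auto simp: J_def)
  ultimately show ?thesis
    by (simp add: total)
qed

end

section \<open>The size of the normalizer\<close>

lemma grid_eq: "0 < M \<Longrightarrow> grid M m = {..<Suc (nat \<lfloor>M * real m\<rfloor>)}"
  by (auto simp: grid_def less_Suc_eq_le le_nat_floor le_nat_iff le_floor_iff)

text \<open>The step function that equals \<open>f (l / m) + C / m\<close> on \<open>[l / m, (l + 1) / m]\<close> dominates \<open>f\<close>, by the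
  one-sided Lipschitz bound inside \<open>[0, M]\<close> and because \<open>f\<close> vanishes outside. Its integral is
  therefore at least one, and it is computed from the normalizer. Only points of \<open>[0, M]\<close> are
  compared, since \<open>f\<close> may jump at the end points.\<close>

lemma normalizer_lower_bound:
  assumes meas: "(\<lambda>x. ennreal (f x)) \<in> borel_measurable lborel"
    and mass: "(\<integral>\<^sup>+x. ennreal (f x) \<partial>lborel) = 1"
    and nonneg: "\<And>x. 0 \<le> f x" and "0 < M"
    and support: "\<And>x. x < 0 \<or> M < x \<Longrightarrow> f x = 0"
    and lip: "\<And>x y. 0 \<le> x \<Longrightarrow> x \<le> y \<Longrightarrow> y \<le> M \<Longrightarrow> f y \<le> f x + C * (y - x)"
    and "0 \<le> C" and "1 \<le> m"
  shows "real m - C * (M + 1) \<le> normalizer f M m"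
proof -
  define N where "N = nat \<lfloor>M * real m\<rfloor>"
  define a where "a l = f (real l / real m) + C / real m" for l :: nat
  define V where "V l = {real l / real m .. real (Suc l) / real m}" for l :: nat
  have m: "0 < real m" using \<open>1 \<le> m\<close> by simp
  have a: "0 \<le> a l" for l using nonneg \<open>0 \<le> C\<close> by (simp add: a_def)
  have le: "f x \<le> (\<Sum>l<Suc N. a l * indicator (V l) x)" for x
  proof (cases "0 \<le> x \<and> x \<le> M")
    case True
    define l where "l = nat \<lfloor>x * real m\<rfloor>"
    have lx: "real l \<le> x * real m" "x * real m < real (Suc l)"
      using True m unfolding l_def by (auto simp: of_nat_floor le_nat_floor) linarith+
    have "x * real m \<le> M * real m" using True m by simp
    then have "l \<le> N" unfolding l_def N_def by (intro nat_mono floor_mono)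
    have "real l / real m \<le> x" "x \<le> real (Suc l) / real m"
      using lx m by (auto simp: divide_le_eq le_divide_eq)
    moreover have "real (Suc l) / real m = real l / real m + 1 / real m"
      by (simp add: add_divide_distrib)
    ultimately have x: "real l / real m \<le> x" "x - real l / real m \<le> 1 / real m" "x \<in> V l"
      by (auto simp: V_def)
    have "f x \<le> f (real l / real m) + C * (x - real l / real m)"
      using True x m by (intro lip) auto
    also have "C * (x - real l / real m) \<le> C * (1 / real m)"
      using x \<open>0 \<le> C\<close> by (intro mult_left_mono) auto
    finally have "f x \<le> a l * indicator (V l) x" using x by (simp add: a_def)
    also have "\<dots> \<le> (\<Sum>l<Suc N. a l * indicator (V l) x)"
      using \<open>l \<le> N\<close> a by (intro member_le_sum) auto
    finally show ?thesis .
  next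
    case False
    then have "f x = 0" by (intro support) auto
    then show ?thesis using a by (simp only:) (intro sum_nonneg mult_nonneg_nonneg, auto)
  qed
  have "1 \<le> (\<integral>\<^sup>+x. ennreal (\<Sum>l<Suc N. a l * indicator (V l) x) \<partial>lborel)"
    unfolding mass[symmetric] by (intro nn_integral_mono ennreal_leI le)
  also have "\<dots> = (\<integral>\<^sup>+x. (\<Sum>l<Suc N. ennreal (a l) * indicator (V l) x) \<partial>lborel)"
    using a by (intro nn_integral_cong, subst sum_ennreal[symmetric])
      (auto simp: ennreal_mult' ennreal_indicator mult_nonneg_nonneg)
  also have "\<dots> = (\<Sum>l<Suc N. ennreal (a l) * emeasure lborel (V l))"
    by (subst nn_integral_sum) (auto simp: nn_integral_cmult_indicator V_def)
  also have "\<dots> = (\<Sum>l<Suc N. ennreal (a l * (1 / real m)))"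
  proof (intro sum.cong refl)
    fix l
    have "emeasure lborel (V l) = ennreal (1 / real m)"
      using m by (simp add: V_def divide_right_mono diff_divide_distrib[symmetric])
    then show "ennreal (a l) * emeasure lborel (V l) = ennreal (a l * (1 / real m))"
      using a by (simp only: ennreal_mult')
  qed
  also have "\<dots> = ennreal (\<Sum>l<Suc N. a l * (1 / real m))"
    using a by (intro sum_ennreal) auto
  finally have "1 \<le> (\<Sum>l<Suc N. a l * (1 / real m))"
    by (simp del: sum.lessThan_Suc)
  also have "\<dots> = (\<Sum>l<Suc N. a l) / real m"
    by (simp only: sum_distrib_right[symmetric]) simp
  finally have "real m \<le> (\<Sum>l<Suc N. a l)"
    using m by (simp only: le_divide_eq_1_pos)
  also have "\<dots> = normalizer f M m + real (Suc N) * (C / real m)"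
    unfolding a_def normalizer_def grid_eq[OF \<open>0 < M\<close>] N_def sum.distrib by simp
  also have "real (Suc N) * (C / real m) \<le> ((M + 1) * real m) * (C / real m)"
  proof (intro mult_right_mono)
    have "real N \<le> M * real m" using \<open>0 < M\<close> m unfolding N_def by (intro of_nat_floor) simp
    then show "real (Suc N) \<le> (M + 1) * real m" using \<open>1 \<le> m\<close> by (simp add: algebra_simps)
    show "0 \<le> C / real m" using \<open>0 \<le> C\<close> by simp
  qed
  also have "((M + 1) * real m) * (C / real m) = C * (M + 1)" using m by simp
  finally show ?thesis by simp
qed

section \<open>Record events of the lattice variables\<close>

lemma comparison_sets_chain:
  fixes n :: "nat \<Rightarrow> nat"
  assumes nested: "\<And>t. 1 \<le> t \<Longrightarrow> Cmp (n t) \<subset> Cmp (n (t + 1))"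
    and pred: "\<And>t. 2 \<le> t \<Longrightarrow> n (t - 1) \<in> Cmp (n t)"
    and "1 \<le> s" "s < t"
  shows "insert (n s) (Cmp (n s)) \<subseteq> Cmp (n t)"
proof -
  have "insert (n s) (Cmp (n s)) \<subseteq> Cmp (n (Suc s + k))" for k
  proof (induction k)
    case 0
    show ?case using nested[of s] pred[of "Suc s"] \<open>1 \<le> s\<close> by auto
  next
    case (Suc k)
    have "Cmp (n (Suc s + k)) \<subset> Cmp (n (Suc s + Suc k))"
      using nested[of "Suc s + k"] by simp
    with Suc show ?case by (blast dest: psubset_imp_subset)
  qed
  from this[of "t - Suc s"] show ?thesis using \<open>s < t\<close> by simp
qed

lemma record_event_eq:
  assumes "finite (Cmp i)"
  shows "record_event P X Cmp i = {\<omega> \<in> space P. \<forall>j\<in>Cmp i. X j \<omega> < X i \<omega>}"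
  using assms by (auto simp: record_event_def)

theorem theorem5:
  fixes \<Omega> :: "'a measure" and X :: "'a \<Rightarrow> real"
    and f f' :: "real \<Rightarrow> real" and M C :: real
    and P :: "nat \<Rightarrow> 'w measure" and Y :: "nat \<Rightarrow> 'w \<Rightarrow> real"
    and Xs :: "nat \<Rightarrow> nat \<Rightarrow> 'w \<Rightarrow> real"
    and n :: "nat \<Rightarrow> nat" and Cmp :: "nat \<Rightarrow> nat set" and I :: "nat set"
  assumes X_space: "prob_space \<Omega>"
    and X_density: "distributed \<Omega> lborel X (\<lambda>x. ennreal (f x))"
    and f_nonneg: "\<And>x. 0 \<le> f x"
    and M_pos: "0 < M"
    and f_support: "\<And>x. x < 0 \<or> M < x \<Longrightarrow> f x = 0"
    and f_deriv: "\<And>x. x \<in> {0..M} \<Longrightarrow> (f has_real_derivative f' x) (at x within {0..M})"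
    and f'_cont: "continuous_on {0..M} f'"
    and C_pos: "0 < C"
    and f_bound: "\<And>x. x \<in> {0..M} \<Longrightarrow> max \<bar>f x\<bar> \<bar>f' x\<bar> \<le> C"
    and P_space: "\<And>m. 1 \<le> m \<Longrightarrow> 0 < normalizer f M m \<Longrightarrow> prob_space (P m)"
    and Y_distribution: "\<And>m. 1 \<le> m \<Longrightarrow> 0 < normalizer f M m \<Longrightarrow>
          has_lattice_distribution (P m) (Y m) f M m"
    and Xs_iid: "\<And>m. 1 \<le> m \<Longrightarrow> 0 < normalizer f M m \<Longrightarrow> iid_copies (P m) (Xs m) (Y m)"
    and n_pos: "\<And>t. 1 \<le> t \<Longrightarrow> 0 < n t"
    and n_strict: "strict_mono_on {1..} n"
    and Cmp_range: "\<And>t. 1 \<le> t \<Longrightarrow> Cmp (n t) \<subseteq> {1..n t - 1}"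
    and Cmp_nested: "\<And>t. 1 \<le> t \<Longrightarrow> Cmp (n t) \<subset> Cmp (n (t + 1))"
    and Cmp_pred: "\<And>t. 2 \<le> t \<Longrightarrow> n (t - 1) \<in> Cmp (n t)"
    and I_finite: "finite I"
    and I_nonempty: "I \<noteq> {}"
    and I_subset: "I \<subseteq> n ` {1..}"
  shows "\<exists>D>0. \<forall>\<^sub>F m in sequentially.
           \<bar>measure (P m) (\<Inter>i\<in>I. record_event (P m) (Xs m) Cmp i)
              - 1 / (\<Prod>i\<in>I. real (rank_count Cmp i))\<bar> \<le> D / real m"
proof -
  have mass: "(\<integral>\<^sup>+x. ennreal (f x) \<partial>lborel) = 1"
    using distributed_emeasure[OF X_density, of UNIV] prob_space.emeasure_space_1[OF X_space] by simp
  have lip: "f y \<le> f x + C * (y - x)" if "0 \<le> x" "x \<le> y" "y \<le> M" for x y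
  proof -
    have "norm (f y - f x) \<le> C * norm (y - x)"
    proof (rule field_differentiable_bound)
      show "convex {0..M}" by simp
      show "norm (f' z) \<le> C" if "z \<in> {0..M}" for z using f_bound[OF that] by simp
    qed (use f_deriv that in auto)
    then show ?thesis using that by simp
  qed
  have chain: "insert i (Cmp i) \<subseteq> Cmp k" if "i \<in> I" "k \<in> I" "i < k" for i k
  proof -
    from that I_subset obtain s t where st: "1 \<le> s" "1 \<le> t" "i = n s" "k = n t"
      unfolding subset_iff image_iff by (metis atLeast_iff)
    then have "s < t"
      using that(3) strict_mono_on_less[OF n_strict, of s t] by simp
    then show ?thesis
      using comparison_sets_chain[of Cmp n s t, OF Cmp_nested Cmp_pred] st by simp
  qed
  have range: "finite (Cmp i) \<and> insert i (Cmp i) \<subseteq> {1..}" "i \<notin> Cmp i" if "i \<in> I" for i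
  proof -
    from that I_subset obtain t where t: "1 \<le> t" "i = n t" by auto
    with Cmp_range[of t] n_pos[of t]
    show "finite (Cmp i) \<and> insert i (Cmp i) \<subseteq> {1..}" "i \<notin> Cmp i"
      by (auto intro: finite_subset)
  qed
  (* The error sum vanishes if all comparison sets are empty; the constant 2 * C * S + 1 is
     positive even then. *)
  define S where "S = real (\<Sum>i\<in>I. card (Cmp i))"
  (* For these m the lower bound m - C * (M + 1) of the normalizer is at least m / 2. *)
  have bound: "\<bar>measure (P m) (\<Inter>i\<in>I. record_event (P m) (Xs m) Cmp i)
      - 1 / (\<Prod>i\<in>I. real (rank_count Cmp i))\<bar> \<le> (2 * C * S + 1) / real m"
    if m: "1 \<le> m" "2 * C * (M + 1) \<le> real m" for m
  proof -
    define Z where "Z = normalizer f M m"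
    define N where "N = Suc (nat \<lfloor>M * real m\<rfloor>)"
    have grid: "grid M m = {..<N}" unfolding N_def by (rule grid_eq[OF M_pos])
    have "real m - C * (M + 1) \<le> Z"
      unfolding Z_def using X_density mass f_nonneg M_pos f_support lip C_pos m
      by (intro normalizer_lower_bound) (auto simp: distributed_def)
    then have Z: "real m / 2 \<le> Z" "0 < Z" using m by auto
    have Y: "has_lattice_distribution (P m) (Y m) f M m"
      and iid: "iid_copies (P m) (Xs m) (Y m)"
      and pm: "prob_space (P m)"
      using Y_distribution Xs_iid P_space m Z by (auto simp: Z_def)
    interpret prob_space "P m" by (rule pm)
    have ind: "indep_vars (\<lambda>_. borel) (Xs m) {1..}"
      and distr: "\<And>j. 1 \<le> j \<Longrightarrow> distr (P m) borel (Xs m j) = distr (P m) borel (Y m)"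
      using iid by (auto simp: iid_copies_def)
    have Ymeas: "Y m \<in> borel_measurable (P m)" using Y by (simp add: has_lattice_distribution_def)
    interpret iid_atomic "P m" "Xs m" "{1..}" "\<lambda>l. real l / real m" "\<lambda>l. f (real l / real m) / Z"
      N "2 * C / real m"
    proof
      show "indep_vars (\<lambda>_. borel) (Xs m) {1..}" by (rule ind)
      show "strict_mono (\<lambda>l. real l / real m)"
        using m by (auto simp: strict_mono_def divide_strict_right_mono)
      show "(\<Sum>l<N. f (real l / real m) / Z) = 1"
        using Z by (simp add: sum_divide_distrib[symmetric] Z_def normalizer_def grid)
      show "0 \<le> f (real l / real m) / Z" for l using f_nonneg Z by simp
      show "f (real l / real m) / Z \<le> 2 * C / real m" if "l < N" for l
      proof -
        have "real l / real m \<in> {0..M}"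
          using that grid m by (auto simp: grid_def field_simps set_eq_iff)
        from f_bound[OF this] have "f (real l / real m) \<le> C" by linarith
        then have "f (real l / real m) / Z \<le> C / (real m / 2)"
          using Z m C_pos by (intro frac_le) auto
        then show ?thesis by (simp add: field_simps)
      qed
      show "prob {\<omega> \<in> space (P m). Xs m j \<omega> = real l / real m} = f (real l / real m) / Z"
        if "j \<in> {1..}" "l < N" for j l
      proof -
        have Xmeas: "Xs m j \<in> borel_measurable (P m)"
          using ind that by (auto simp: indep_vars_def)
        have eq: "W -` {x} \<inter> space (P m) = {\<omega> \<in> space (P m). W \<omega> = x}" for W :: "'w \<Rightarrow> real" and x
          by auto
        have "prob {\<omega> \<in> space (P m). Xs m j \<omega> = real l / real m}
            = measure (distr (P m) borel (Xs m j)) {real l / real m}"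
          using Xmeas by (simp add: measure_distr eq)
        also have "\<dots> = prob {\<omega> \<in> space (P m). Y m \<omega> = real l / real m}"
          using Ymeas that by (simp add: distr measure_distr eq)
        also have "\<dots> = f (real l / real m) / Z"
          using Y that grid by (simp add: has_lattice_distribution_def Z_def)
        finally show ?thesis .
      qed
    qed
    have "(\<Inter>i\<in>I. record_event (P m) (Xs m) Cmp i)
        = {\<omega> \<in> space (P m). \<forall>i\<in>I. \<forall>j\<in>Cmp i. Xs m j \<omega> < Xs m i \<omega>}"
      using range I_nonempty by (auto simp: record_event_eq)
    then have "\<bar>prob (\<Inter>i\<in>I. record_event (P m) (Xs m) Cmp i)
        - 1 / (\<Prod>i\<in>I. real (rank_count Cmp i))\<bar> \<le> S * (2 * C / real m)"
      unfolding S_def using records_error[OF I_finite, of Cmp] range chain by simp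
    also have "\<dots> \<le> (2 * C * S + 1) / real m"
      by (simp add: add_divide_distrib mult.commute)
    finally show ?thesis .
  qed
  have "\<forall>\<^sub>F m in sequentially. 1 \<le> m \<and> 2 * C * (M + 1) \<le> real m"
    using eventually_ge_at_top[of 1] eventually_ge_at_top[of "nat \<lceil>2 * C * (M + 1)\<rceil>"]
    by eventually_elim (simp add: nat_ceiling_le_eq)
  then have "\<forall>\<^sub>F m in sequentially.
      \<bar>measure (P m) (\<Inter>i\<in>I. record_event (P m) (Xs m) Cmp i)
        - 1 / (\<Prod>i\<in>I. real (rank_count Cmp i))\<bar> \<le> (2 * C * S + 1) / real m"
    by eventually_elim (use bound in auto)
  moreover have "0 < 2 * C * S + 1"
  proof -
    have "0 \<le> S" unfolding S_def by (rule of_nat_0_le_iff)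
    then show ?thesis using C_pos by (intro add_nonneg_pos mult_nonneg_nonneg) auto
  qed
  ultimately show ?thesis by blast
qed

end
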